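(* Let $n\ge 1$, let $\mathcal{G}$ be a colored group field theory (CGFT) graph with $n+1$ colors, possibly with external halflines, and let $\mathcal{G}_{\partial}$ be its boundary graph. For $0\le p\le n$ let $\mathfrak{B}^p_{\partial}$ be the set of boundary $p$-bubbles of $\mathcal{G}_{\partial}$, and let $d^{\partial}_p$ be the $\mathbb{Z}$-linear operator on the free abelian group generated by $\mathfrak{B}^p_{\partial}$ (with values, for $p\ge1$, in the free abelian group generated by $\mathfrak{B}^{p-1}_{\partial}$) given on a boundary $p$-bubble $(\mathcal{B}_{\partial})^{\mathcal{C}}_{\mathcal{V}_{\partial}}$ with colors $\mathcal{C}=\{i_1<\dots<i_{p+1}\}$ and vertex set $\mathcal{V}_{\partial}$ by $$d^{\partial}_p\big[(\mathcal{B}_{\partial})^{\mathcal{C}}_{\mathcal{V}_{\partial}}\big]=\sum_{q=1}^{p+1}(-1)^{q+1}\sum_{\substack{(\mathcal{B}'_{\partial})^{\mathcal{C}'}_{\mathcal{V}'_{\partial}}\in\mathfrak{B}^{p-1}_{\partial}\\ \mathcal{V}'_{\partial}\subset\mathcal{V}_{\partial},\ \mathcal{C}'=\mathcal{C}\setminus\{i_q\}}}(\mathcal{B}'_{\partial})^{\mathcal{C}'}_{\mathcal{V}'_{\partial}}\qquad (p\ge 1),$$ and $d^{\partial}_0=0$. Then for every $p$ with $1\le p\le n$, $$d^{\partial}_{p-1}\circ d^{\partial}_p=0 .$$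
   Context: CGFT graph with $n+1$ colors: a finite graph (multiple lines allowed) whose vertex set is a disjoint union of positive and negative vertices, in which every line joins a positive vertex to a negative vertex and carries a color in $\{0,\dots,n\}$. Vertices may also carry external halflines (attached to a single vertex), each with a color in $\{0,\dots,n\}$. At each vertex, each color in $\{0,\dots,n\}$ appears exactly once among the lines and halflines touching it. Strands: in the stranded representation, each line or halfline of color $i$ carries $n$ parallel strands, one for each color $j\ne i$; the strand is labeled by the couple $\{i,j\}$. Inside a vertex, the strand $\{i,j\}$ of the line/halfline of color $i$ is connected to the strand $\{i,j\}$ of the line/halfline of color $j$ at that vertex. Thus, for each pair of colors $\{i,j\}$, the strands of label $\{i,j\}$ correspond to the maximal connected components of the graph on all vertices with only the lines of colors $i$ and $j$: such a component is either a closed cycle (closed strand) or a path, possibly a single vertex with no lines (open strand). An open strand of colors $ij$ ends on exactly two distinct external halflines, each of color $i$ or $j$, located at the end vertices of the path (both at the same vertex if the path is a single vertex). Boundary graph $\mathcal{G}_{\partial}$: it has one vertex for each external halfline of $\mathcal{G}$, carrying the color of that halfline, and one line for each open strand of $\mathcal{G}$, joining the two vertices corresponding to the two external halflines on which the strand ends, and carrying the couple of colors $ij$ of the strand. Boundary bubbles: the boundary $0$-bubbles are the vertices of $\mathcal{G}_{\partial}$, the color set of a vertex $w$ being $\{i\}$, where $i$ is the color of $w$. For $p\ge1$ and a color set $\mathcal{C}\subset\{0,\dots,n\}$ with $|\mathcal{C}|=p+1$, the boundary $p$-bubbles with colors $\mathcal{C}$ are the maximal connected components of the graph formed by the vertices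 of $\mathcal{G}_{\partial}$ with color in $\mathcal{C}$ and the lines of $\mathcal{G}_{\partial}$ with colors $i_ai_b$ such that $\{i_a,i_b\}\subset\mathcal{C}$. The bubble with colors $\mathcal{C}$ and vertex set $\mathcal{V}_{\partial}$ is denoted $(\mathcal{B}_{\partial})^{\mathcal{C}}_{\mathcal{V}_{\partial}}$. *)

theory Defs
  imports "HOL-Algebra.Free_Abelian_Groups"
begin

section \<open>Colored group field theory graphs\<close>

record ('v, 'l, 'h) cgft =
  pos_verts :: "'v set"
  neg_verts :: "'v set"
  glines :: "'l set"
  pos_end :: "'l \<Rightarrow> 'v"
  neg_end :: "'l \<Rightarrow> 'v"
  line_col :: "'l \<Rightarrow> nat"
  halflines :: "'h set"
  half_end :: "'h \<Rightarrow> 'v"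
  half_col :: "'h \<Rightarrow> nat"

definition gverts :: "('v, 'l, 'h) cgft \<Rightarrow> 'v set" where
  "gverts G = pos_verts G \<union> neg_verts G"

definition line_ends :: "('v, 'l, 'h) cgft \<Rightarrow> 'l \<Rightarrow> 'v set" where
  "line_ends G l = {pos_end G l, neg_end G l}"

text \<open>
  In the last axiom the disjoint sum \<open><+>\<close> collects the lines and the halflines of color \<open>i\<close>
  touching \<open>v\<close>. Graphs are not required to be connected or nonempty.
\<close>

locale cgft_graph =
  fixes n :: nat and G :: "('v, 'l, 'h) cgft"
  assumes finite_pos_verts: "finite (pos_verts G)"
    and finite_neg_verts: "finite (neg_verts G)"
    and finite_glines: "finite (glines G)"
    and finite_halflines: "finite (halflines G)"
    and pos_neg_disjoint: "pos_verts G \<inter> neg_verts G = {}"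
    and pos_end: "l \<in> glines G \<Longrightarrow> pos_end G l \<in> pos_verts G"
    and neg_end: "l \<in> glines G \<Longrightarrow> neg_end G l \<in> neg_verts G"
    and line_col: "l \<in> glines G \<Longrightarrow> line_col G l \<in> {0..n}"
    and half_end: "h \<in> halflines G \<Longrightarrow> half_end G h \<in> gverts G"
    and half_col: "h \<in> halflines G \<Longrightarrow> half_col G h \<in> {0..n}"
    and color_exactly_once: "\<lbrakk>v \<in> gverts G; i \<in> {0..n}\<rbrakk> \<Longrightarrow>
      \<exists>!x. x \<in> {l \<in> glines G. v \<in> line_ends G l \<and> line_col G l = i} <+>
               {h \<in> halflines G. half_end G h = v \<and> half_col G h = i}"

section \<open>Connected components and strands\<close>

text \<open>
  Vertex sets of the maximal connected components of the graph with vertex set \<open>V\<close> and symmetric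
  adjacency relation \<open>R \<subseteq> V \<times> V\<close>; isolated vertices form singleton components.
\<close>

definition components :: "'a set \<Rightarrow> ('a \<times> 'a) set \<Rightarrow> 'a set set" where
  "components V R = V // Restr (R\<^sup>*) V"

definition color_adj :: "('v, 'l, 'h) cgft \<Rightarrow> nat set \<Rightarrow> ('v \<times> 'v) set" where
  "color_adj G c = {(u, v). \<exists>l\<in>glines G. line_col G l \<in> c \<and> line_ends G l = {u, v}}"

text \<open>
  A strand is identified by its couple of colors \<open>c = {i, j}\<close> together with the vertex set of the
  corresponding component of the graph formed by all vertices and the lines of colors \<open>i\<close>, \<open>j\<close>.
\<close>

definition strands :: "nat \<Rightarrow> ('v, 'l, 'h) cgft \<Rightarrow> (nat set \<times> 'v set) set" where
  "strands n G = {(c, V). c \<subseteq> {0..n} \<and> card c = 2 \<and> V \<in> components (gverts G) (color_adj G c)}"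

definition component_lines :: "('v, 'l, 'h) cgft \<Rightarrow> nat set \<Rightarrow> 'v set \<Rightarrow> 'l set" where
  "component_lines G c V = {l \<in> glines G. line_col G l \<in> c \<and> line_ends G l \<subseteq> V}"

text \<open>
  The component is a path: its vertices are \<open>vs\<close> and all its lines are \<open>ls\<close>, the \<open>k\<close>-th line
  joining the \<open>k\<close>-th vertex to the next one. In particular two vertices joined by both a line of
  color \<open>i\<close> and one of color \<open>j\<close> are a closed strand.
\<close>

definition is_path :: "('v, 'l, 'h) cgft \<Rightarrow> nat set \<Rightarrow> 'v set \<Rightarrow> bool" where
  "is_path G c V \<longleftrightarrow> (\<exists>vs ls. distinct vs \<and> set vs = V \<and>
     distinct ls \<and> set ls = component_lines G c V \<and> length vs = Suc (length ls) \<and>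
     (\<forall>k < length ls. line_ends G (ls ! k) = {vs ! k, vs ! Suc k}))"

definition open_strands :: "nat \<Rightarrow> ('v, 'l, 'h) cgft \<Rightarrow> (nat set \<times> 'v set) set" where
  "open_strands n G = {(c, V) \<in> strands n G. is_path G c V}"

definition strand_ends :: "('v, 'l, 'h) cgft \<Rightarrow> nat set \<times> 'v set \<Rightarrow> 'h set" where
  "strand_ends G s = {h \<in> halflines G. half_col G h \<in> fst s \<and> half_end G h \<in> snd s}"

section \<open>The boundary graph and its bubbles\<close>

record ('w, 's) bgraph =
  bverts :: "'w set"
  bvert_col :: "'w \<Rightarrow> nat"
  blines :: "'s set"
  bline_ends :: "'s \<Rightarrow> 'w set"
  bline_col :: "'s \<Rightarrow> nat set"

definition boundary_graph ::
  "nat \<Rightarrow> ('v, 'l, 'h) cgft \<Rightarrow> ('h, nat set \<times> 'v set) bgraph" where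
  "boundary_graph n G =
    \<lparr>bverts = halflines G, bvert_col = half_col G,
     blines = open_strands n G, bline_ends = strand_ends G, bline_col = fst\<rparr>"

definition color_verts :: "('w, 's) bgraph \<Rightarrow> nat set \<Rightarrow> 'w set" where
  "color_verts B C = {w \<in> bverts B. bvert_col B w \<in> C}"

definition bubble_adj :: "('w, 's) bgraph \<Rightarrow> nat set \<Rightarrow> ('w \<times> 'w) set" where
  "bubble_adj B C = {(w, w'). w \<in> color_verts B C \<and> w' \<in> color_verts B C \<and>
     (\<exists>s\<in>blines B. bline_col B s \<subseteq> C \<and> bline_ends B s = {w, w'})}"

text \<open>A bubble is the pair of its color set and its vertex set.\<close>

definition bubbles :: "nat \<Rightarrow> ('w, 's) bgraph \<Rightarrow> nat \<Rightarrow> (nat set \<times> 'w set) set" where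
  "bubbles n B p =
    (if p = 0 then {({bvert_col B w}, {w}) | w. w \<in> bverts B}
     else {(C, V). C \<subseteq> {0..n} \<and> card C = p + 1 \<and> V \<in> components (color_verts B C) (bubble_adj B C)})"

text \<open>
  Elements of the free abelian group on a set are finitely supported integer-valued functions;
  \<open>frag_extend\<close> is the \<open>\<int>\<close>-linear extension of a map given on generators. The entry
  \<open>sorted_list_of_set C ! (q - 1)\<close> is \<open>i\<^sub>q\<close> for \<open>C = {i\<^sub>1 < \<dots> < i\<^sub>p\<^sub>+\<^sub>1}\<close>.
\<close>

definition bubble_d_gen ::
  "nat \<Rightarrow> ('w, 's) bgraph \<Rightarrow> nat \<Rightarrow> nat set \<times> 'w set \<Rightarrow> (nat set \<times> 'w set) \<Rightarrow>\<^sub>0 int" where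
  "bubble_d_gen n B p = (\<lambda>(C, V).
     \<Sum>q = 1..p + 1. frag_cmul ((-1) ^ (q + 1))
       (\<Sum>(C', V') \<in> {(C', V') \<in> bubbles n B (p - 1).
                        V' \<subseteq> V \<and> C' = C - {sorted_list_of_set C ! (q - 1)}}.
          frag_of (C', V')))"

definition bubble_d ::
  "nat \<Rightarrow> ('w, 's) bgraph \<Rightarrow> nat \<Rightarrow>
    ((nat set \<times> 'w set) \<Rightarrow>\<^sub>0 int) \<Rightarrow> ((nat set \<times> 'w set) \<Rightarrow>\<^sub>0 int)" where
  "bubble_d n B p = (if p = 0 then (\<lambda>_. 0) else frag_extend (bubble_d_gen n B p))"

section \<open>Consistency of the definitions\<close>

lemma bubble_d_frag_of:
  "p \<ge> 1 \<Longrightarrow> bubble_d n B p (frag_of b) = bubble_d_gen n B p b"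
  by (simp add: bubble_d_def)

lemma keys_bubble_d_gen: "Poly_Mapping.keys (bubble_d_gen n B p b) \<subseteq> bubbles n B (p - 1)"
proof -
  obtain C V where b: "b = (C, V)" by (cases b)
  have *: "Poly_Mapping.keys (\<Sum>(C', V') \<in> {(C', V') \<in> bubbles n B (p - 1). P C' V'}. frag_of (C', V'))
      \<subseteq> bubbles n B (p - 1)" for P
    by (rule order_trans[OF keys_sum]) auto
  show ?thesis
    unfolding b bubble_d_gen_def prod.case
    by (rule order_trans[OF keys_sum], rule UN_least, rule order_trans[OF keys_cmul], rule *)
qed

lemma bubble_d_hom:
  assumes "p \<ge> 1"
  shows "bubble_d n B p \<in> hom (free_Abelian_group (bubbles n B p))
                              (free_Abelian_group (bubbles n B (p - 1)))"
proof (rule homI)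
  fix x
  have "Poly_Mapping.keys (bubble_d n B p x) \<subseteq> bubbles n B (p - 1)"
    using keys_frag_extend[of "bubble_d_gen n B p" x] keys_bubble_d_gen[of n B p] assms
    unfolding bubble_d_def by fastforce
  then show "bubble_d n B p x \<in> carrier (free_Abelian_group (bubbles n B (p - 1)))"
    by simp
qed (use assms in \<open>simp add: bubble_d_def frag_extend_add\<close>)

lemma components_closed:
  assumes "V \<in> components X R" "u \<in> V" "(u, v) \<in> R" "v \<in> X"
  shows "v \<in> V"
  using assms unfolding components_def quotient_def
  by (auto intro: rtrancl_into_rtrancl)

lemma (in cgft_graph) open_strand_two_ends:
  assumes "s \<in> open_strands n G"
  shows "card (strand_ends G s) = 2"
proof -
  obtain c V where s: "s = (c, V)" by (cases s)
  have c: "c \<subseteq> {0..n}" "card c = 2" and V: "V \<in> components (gverts G) (color_adj G c)"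
    and path: "is_path G c V"
    using assms by (auto simp: s open_strands_def strands_def)
  have fc: "finite c" using c(2) card.infinite by fastforce
  have VG: "V \<subseteq> gverts G" using V by (auto simp: components_def quotient_def)
  have fV: "finite V"
    using VG finite_pos_verts finite_neg_verts by (auto simp: gverts_def intro: finite_subset)
  let ?E = "component_lines G c V"
  let ?H = "strand_ends G s"
  have fE: "finite ?E" and fH: "finite ?H"
    using finite_glines finite_halflines by (auto simp: component_lines_def strand_ends_def)
  have cards: "card V = card ?E + 1"
  proof -
    obtain vs ls where "distinct vs" "set vs = V" "distinct ls" "set ls = ?E"
      "length vs = Suc (length ls)"
      using path unfolding is_path_def by blast
    then show ?thesis by (metis distinct_card Suc_eq_plus1)
  qed
  let ?L = "\<lambda>v i. {l \<in> glines G. v \<in> line_ends G l \<and> line_col G l = i}"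
  let ?K = "\<lambda>v i. {h \<in> halflines G. half_end G h = v \<and> half_col G h = i}"
  have one: "card (?L v i <+> ?K v i) = 1" if "v \<in> V" "i \<in> c" for v i
  proof -
    have "\<exists>!x. x \<in> ?L v i <+> ?K v i"
      using color_exactly_once[of v i] that VG c(1) by blast
    then obtain x where "?L v i <+> ?K v i = {x}" by blast
    then show ?thesis by simp
  qed
  have closed: "line_ends G l \<subseteq> V"
    if "l \<in> glines G" "line_col G l \<in> c" "v \<in> line_ends G l" "v \<in> V" for l v
  proof
    fix w assume "w \<in> line_ends G l"
    then have "w = v \<or> (v, w) \<in> color_adj G c"
      using that by (auto simp: color_adj_def line_ends_def)
    moreover have "w \<in> gverts G"
      using \<open>w \<in> line_ends G l\<close> pos_end[OF that(1)] neg_end[OF that(1)]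
      by (auto simp: line_ends_def gverts_def)
    ultimately show "w \<in> V" using components_closed[OF V that(4)] that(4) by blast
  qed
  let ?f = "\<lambda>((v, i), x). (case x of Inl l \<Rightarrow> Inl (l, v) | Inr h \<Rightarrow> Inr h)"
  have bij: "bij_betw ?f (SIGMA (v, i) : V \<times> c. ?L v i <+> ?K v i)
                ((SIGMA l : ?E. line_ends G l) <+> ?H)"
  proof (rule bij_betw_imageI)
    show "inj_on ?f (SIGMA (v, i) : V \<times> c. ?L v i <+> ?K v i)"
      by (auto simp: inj_on_def)
    show "?f ` (SIGMA (v, i) : V \<times> c. ?L v i <+> ?K v i) = (SIGMA l : ?E. line_ends G l) <+> ?H"
      (is "?f ` ?A = ?B")
    proof (intro equalityI subsetI)
      fix y assume "y \<in> ?f ` ?A"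
      then show "y \<in> ?B"
        by (auto simp: component_lines_def strand_ends_def s) (use closed in blast)+
    next
      fix y assume "y \<in> ?B"
      then show "y \<in> ?f ` ?A"
      proof (elim PlusE)
        fix a assume y: "y = Inl a" "a \<in> (SIGMA l : ?E. line_ends G l)"
        obtain l v where a: "a = (l, v)" by (cases a)
        have "((v, line_col G l), Inl l) \<in> ?A"
          using y a by (auto simp: component_lines_def)
        then show ?thesis using y a by (force intro: rev_image_eqI)
      next
        fix h assume y: "y = Inr h" "h \<in> ?H"
        have "((half_end G h, half_col G h), Inr h) \<in> ?A"
          using y by (auto simp: strand_ends_def s)
        then show ?thesis using y by (force intro: rev_image_eqI)
      qed
    qed
  qed
  have "card (SIGMA (v, i) : V \<times> c. ?L v i <+> ?K v i)
      = (\<Sum>z \<in> V \<times> c. card (case z of (v, i) \<Rightarrow> ?L v i <+> ?K v i))"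
    using fV fc finite_glines finite_halflines by (intro card_SigmaI) auto
  also have "\<dots> = (\<Sum>z \<in> V \<times> c. 1)"
  proof (rule sum.cong)
    fix z assume "z \<in> V \<times> c"
    then obtain v i where "z = (v, i)" "v \<in> V" "i \<in> c" by blast
    then show "card (case z of (v, i) \<Rightarrow> ?L v i <+> ?K v i) = 1"
      by (simp only: prod.case one)
  qed simp
  also have "\<dots> = 2 * card V" using c(2) by (simp add: card_cartesian_product)
  finally have 1: "card ((SIGMA l : ?E. line_ends G l) <+> ?H) = 2 * card V"
    using bij_betw_same_card[OF bij] by simp
  have two: "card (line_ends G l) = 2" if "l \<in> ?E" for l
    using that pos_end[of l] neg_end[of l] pos_neg_disjoint
    by (auto simp: line_ends_def component_lines_def card_insert_if)
  have fl: "finite (line_ends G l)" for l by (simp add: line_ends_def)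
  have "card (SIGMA l : ?E. line_ends G l) = 2 * card ?E"
    using fE fl two by (simp add: card_SigmaI)
  then have "2 * card ?E + card ?H = 2 * card V"
    using 1 fE fl fH by (simp add: card_Plus)
  then show ?thesis using cards by simp
qed

end

theory Submission
  imports Defs
begin

text \<open>
  Deleting the colors \<open>a\<close> and \<open>b\<close> from a bubble in either order yields the same sum: connectivity
  is monotone in the color set, so each bubble with colors \<open>C - {a, b}\<close> inside a \<open>C\<close>-bubble \<open>V\<close> lies
  in exactly one bubble with colors \<open>C - {a}\<close>, and that bubble lies inside \<open>V\<close>. The two orders
  carry opposite signs, as for simplices.
\<close>

section \<open>Containment of bubbles\<close>

text \<open>Makes \<open>components\<close> a set of equivalence classes, so that facts about
  \<open>quotient\<close> apply. Symmetry is the only demand on \<open>R\<close>: restricting the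
  transitive relation \<open>R\<^sup>*\<close> to \<open>X\<close> keeps it transitive even when
  paths leave \<open>X\<close>.\<close>

lemma equiv_components:
  assumes "sym R"
  shows "equiv X (Restr (R\<^sup>*) X)"
proof (rule equivI)
  show "Restr (R\<^sup>*) X \<subseteq> X \<times> X" by blast
  show "refl_on X (Restr (R\<^sup>*) X)" by (auto simp: refl_on_def)
  show "sym (Restr (R\<^sup>*) X)" using symD[OF sym_rtrancl[OF assms]] by (auto simp: sym_def)
  show "trans (Restr (R\<^sup>*) X)" by (rule trans_Restr[OF trans_rtrancl])
qed

lemma sym_bubble_adj: "sym (bubble_adj B C)"
  by (auto simp: sym_def bubble_adj_def insert_commute)

lemma bubble_adj_mono: "C \<subseteq> D \<Longrightarrow> bubble_adj B C \<subseteq> bubble_adj B D"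
  unfolding bubble_adj_def color_verts_def by blast

lemma color_verts_mono: "C \<subseteq> D \<Longrightarrow> color_verts B C \<subseteq> color_verts B D"
  unfolding color_verts_def by blast

lemma bubble_subset_color_verts:
  assumes "(C, V) \<in> bubbles n B p"
  shows "V \<subseteq> color_verts B C"
  using assms
  by (auto simp: bubbles_def components_def quotient_def color_verts_def split: if_splits)

lemma bubble_nonempty:
  assumes "(C, V) \<in> bubbles n B p"
  shows "V \<noteq> {}"
  using assms
  by (auto simp: bubbles_def components_def quotient_def split: if_splits)

lemma bubble_connected:
  assumes "(C, V) \<in> bubbles n B p" "u \<in> V" "v \<in> V"
  shows "(u, v) \<in> (bubble_adj B C)\<^sup>*"
proof (cases "p = 0")
  case True
  then show ?thesis using assms by (auto simp: bubbles_def)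
next
  case False
  then have "V \<in> color_verts B C // Restr ((bubble_adj B C)\<^sup>*) (color_verts B C)"
    using assms(1) by (simp add: bubbles_def components_def)
  from quotient_eq_iff[OF equiv_components[OF sym_bubble_adj] this this assms(2,3)]
  show ?thesis by simp
qed

text \<open>A path with colors in \<open>C\<close> is also a path with colors in \<open>D\<close>,
  and \<open>W\<close> is closed under reachability along such paths. For \<open>C = D\<close>, used
  in both directions, this says that bubbles of the same colors sharing a vertex coincide.\<close>

lemma bubble_subset_bubble:
  assumes "(C, V) \<in> bubbles n B p" "(D, W) \<in> bubbles n B r" "r \<ge> 1" "C \<subseteq> D"
    and "u \<in> V" "u \<in> W"
  shows "V \<subseteq> W"
proof
  fix v assume v: "v \<in> V"
  have W: "W \<in> color_verts B D // Restr ((bubble_adj B D)\<^sup>*) (color_verts B D)"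
    using assms(2,3) by (auto simp: bubbles_def components_def)
  have "V \<subseteq> color_verts B D"
    using bubble_subset_color_verts[OF assms(1)] color_verts_mono[OF assms(4)] by (rule order_trans)
  moreover have "(u, v) \<in> (bubble_adj B D)\<^sup>*"
    using bubble_connected[OF assms(1,5) v] rtrancl_mono[OF bubble_adj_mono[OF assms(4), of B]]
    by blast
  ultimately have "(u, v) \<in> Restr ((bubble_adj B D)\<^sup>*) (color_verts B D)"
    using v assms(5) by blast
  then show "v \<in> W"
    using in_quotient_imp_closed[OF equiv_components[OF sym_bubble_adj] W assms(6)] by blast
qed

lemma bubble_exists:
  assumes "u \<in> color_verts B C" "C \<subseteq> {0..n}" "card C = p + 1" "p \<ge> 1"
  obtains V where "(C, V) \<in> bubbles n B p" "u \<in> V"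
proof
  let ?V = "Restr ((bubble_adj B C)\<^sup>*) (color_verts B C) `` {u}"
  show "(C, ?V) \<in> bubbles n B p"
    using assms by (auto simp: bubbles_def components_def intro: quotientI)
  show "u \<in> ?V" using assms(1) by auto
qed

text \<open>Guards against the default value 0 of sums over infinite sets and provides the
  finiteness that linearity and disjoint unions require.\<close>

lemma finite_bubbles:
  assumes "finite (bverts B)"
  shows "finite (bubbles n B p)"
proof (cases "p = 0")
  case True
  then show ?thesis using assms by (simp add: bubbles_def)
next
  case False
  then have "C \<subseteq> {0..n} \<and> V \<subseteq> bverts B" if "(C, V) \<in> bubbles n B p" for C V
    using that bubble_subset_color_verts[OF that] by (auto simp: bubbles_def color_verts_def)
  then have "bubbles n B p \<subseteq> Pow {0..n} \<times> Pow (bverts B)"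
    by auto
  then show ?thesis
    using assms by (meson finite_Pow_iff finite_SigmaI finite_atLeastAtMost finite_subset)
qed

section \<open>The boundary operator indexed by colors\<close>

text \<open>The index set of the inner sum in \<open>bubble_d_gen\<close>. Its color component is
  constant but kept, so that unfolding both definitions matches the two sums literally.\<close>

definition sub_bubbles :: "nat \<Rightarrow> ('w, 's) bgraph \<Rightarrow> nat \<Rightarrow> nat set \<Rightarrow> 'w set \<Rightarrow> (nat set \<times> 'w set) set"
  where "sub_bubbles n B p C V = {(C', V') \<in> bubbles n B p. V' \<subseteq> V \<and> C' = C}"

lemma finite_sub_bubbles: "finite (bverts B) \<Longrightarrow> finite (sub_bubbles n B p C V)"
  by (rule finite_subset[OF _ finite_bubbles[of B n p]]) (auto simp: sub_bubbles_def)

lemma sub_bubbles_sub_bubbles: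
  assumes "(C, V) \<in> bubbles n B r" "r \<ge> 1" "D \<subseteq> C" "card D = p + 1" "p \<ge> 1" "E \<subseteq> D"
  shows "sub_bubbles n B s E V = (\<Union>(D', W) \<in> sub_bubbles n B p D V. sub_bubbles n B s E W)"
proof (intro equalityI subsetI)
  fix x assume "x \<in> sub_bubbles n B s E V"
  then obtain U where x: "x = (E, U)" and U: "(E, U) \<in> bubbles n B s" "U \<subseteq> V"
    by (auto simp: sub_bubbles_def)
  \<comment> \<open>Any vertex of \<open>U\<close> fixes the intermediate bubble: \<open>W\<close>
    is the component of \<open>u\<close> for the colors \<open>D\<close>. Sharing \<open>u\<close>
    then forces both \<open>U \<subseteq> W\<close> and \<open>W \<subseteq> V\<close>.\<close>
  obtain u where u: "u \<in> U" using bubble_nonempty[OF U(1)] by blast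
  have "u \<in> color_verts B D"
    using u bubble_subset_color_verts[OF U(1)] color_verts_mono[OF assms(6), of B] by blast
  moreover have "D \<subseteq> {0..n}"
    using assms(1-3) by (auto simp: bubbles_def)
  ultimately obtain W where W: "(D, W) \<in> bubbles n B p" "u \<in> W"
    by (rule bubble_exists[OF _ _ assms(4,5)])
  have "U \<subseteq> W" by (rule bubble_subset_bubble[OF U(1) W(1) assms(5,6) u W(2)])
  moreover have "W \<subseteq> V"
    by (rule bubble_subset_bubble[OF W(1) assms(1-3) W(2)]) (use u U(2) in blast)
  ultimately show "x \<in> (\<Union>(D', W) \<in> sub_bubbles n B p D V. sub_bubbles n B s E W)"
    using x U(1) W(1) by (auto simp: sub_bubbles_def)
qed (auto simp: sub_bubbles_def)

text \<open>The union in \<open>sub_bubbles_sub_bubbles\<close> is disjoint: a bubble inside both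
  \<open>W\<close> and \<open>W'\<close> is nonempty, so they share a vertex and are equal. Hence
  each term is counted once.\<close>

lemma sum_sub_bubbles_sub_bubbles:
  assumes "finite (bverts B)"
    and "(C, V) \<in> bubbles n B r" "r \<ge> 1" "D \<subseteq> C" "card D = p + 1" "p \<ge> 1" "E \<subseteq> D"
  shows "(\<Sum>(D', W) \<in> sub_bubbles n B p D V. \<Sum>x \<in> sub_bubbles n B s E W. f x)
    = (\<Sum>x \<in> sub_bubbles n B s E V. f x)"
proof -
  have disj: "sub_bubbles n B s E W \<inter> sub_bubbles n B s E W' = {}"
    if "(D, W) \<in> bubbles n B p" "(D, W') \<in> bubbles n B p" "W \<noteq> W'" for W W'
  proof (rule ccontr)
    assume "\<not> ?thesis"
    then obtain U where U: "(E, U) \<in> bubbles n B s" "U \<subseteq> W" "U \<subseteq> W'"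
      by (auto simp: sub_bubbles_def)
    obtain u where "u \<in> W" "u \<in> W'" using bubble_nonempty[OF U(1)] U(2,3) by blast
    then have "W \<subseteq> W'" "W' \<subseteq> W"
      using bubble_subset_bubble[OF that(1,2) assms(6) order_refl]
        bubble_subset_bubble[OF that(2,1) assms(6) order_refl] by simp_all
    then show False using that(3) by simp
  qed
  have "(\<Sum>x \<in> sub_bubbles n B s E V. f x)
      = (\<Sum>x \<in> (\<Union>y \<in> sub_bubbles n B p D V. sub_bubbles n B s E (snd y)). f x)"
    by (simp only: sub_bubbles_sub_bubbles[OF assms(2-7)] case_prod_beta')
  also have "\<dots> = (\<Sum>y \<in> sub_bubbles n B p D V. \<Sum>x \<in> sub_bubbles n B s E (snd y). f x)"
  proof (intro sum.UNION_disjoint finite_sub_bubbles assms(1) ballI impI)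
    fix y z assume "y \<in> sub_bubbles n B p D V" "z \<in> sub_bubbles n B p D V" "y \<noteq> z"
    then have "(D, snd y) \<in> bubbles n B p" "(D, snd z) \<in> bubbles n B p" "snd y \<noteq> snd z"
      by (auto simp: sub_bubbles_def)
    then show "sub_bubbles n B s E (snd y) \<inter> sub_bubbles n B s E (snd z) = {}"
      by (rule disj)
  qed
  finally show ?thesis by (simp only: case_prod_beta')
qed

text \<open>The sign of deleting \<open>a\<close>, expressed without positions in a list: if
  \<open>a\<close> is the \<open>q\<close>-th color, then \<open>q - 1\<close> colors are smaller,
  and \<open>q - 1\<close> and \<open>q + 1\<close> have the same parity.\<close>

definition color_sign :: "nat set \<Rightarrow> nat \<Rightarrow> int" where
  "color_sign C a = (-1) ^ card {x \<in> C. x < a}"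

text \<open>Since the sorted list is strictly increasing, the colors below its entry at index
  \<open>k\<close> are exactly the entries at the \<open>k\<close> earlier indices.\<close>

lemma color_sign_sorted_list_of_set:
  assumes "finite C" "k < card C"
  shows "color_sign C (sorted_list_of_set C ! k) = (-1) ^ k"
proof -
  let ?xs = "sorted_list_of_set C"
  have less: "?xs ! i < ?xs ! j" if "i < j" "j < card C" for i j
    using that sorted_wrt_nth_less[OF strict_sorted_list_of_set, of i j C] by simp
  have "i < k" if "?xs ! i < ?xs ! k" "i < card C" for i
    using that less[of k i] by (cases i k rule: linorder_cases) auto
  moreover have "(x \<in> C) = (\<exists>i < card C. x = ?xs ! i)" for x
    using assms(1) in_set_conv_nth[of x ?xs] by auto
  ultimately have "{x \<in> C. x < ?xs ! k} = (!) ?xs ` {..<k}"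
    using less[OF _ assms(2)] assms(2) by (auto simp: image_iff Bex_def) (metis less_trans)+
  moreover have "inj_on ((!) ?xs) {..<k}"
    using assms(2) by (intro inj_on_nth) auto
  ultimately show ?thesis
    by (simp add: color_sign_def card_image)
qed

lemma bubble_d_gen_eq:
  assumes "card C = p + 1"
  shows "bubble_d_gen n B p (C, V) =
    (\<Sum>a \<in> C. frag_cmul (color_sign C a) (\<Sum>x \<in> sub_bubbles n B (p - 1) (C - {a}) V. frag_of x))"
proof -
  let ?xs = "sorted_list_of_set C"
  let ?F = "\<lambda>a. \<Sum>x \<in> sub_bubbles n B (p - 1) (C - {a}) V. frag_of x"
  have fin: "finite C" using assms card.infinite by fastforce
  have "bubble_d_gen n B p (C, V) = (\<Sum>q = 1..p + 1. frag_cmul ((-1) ^ (q + 1)) (?F (?xs ! (q - 1))))"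
    by (simp add: bubble_d_gen_def sub_bubbles_def)
  \<comment> \<open>Shift to indices from 0 by \<open>q = k + 1\<close>; the exponent
    \<open>q + 1\<close> becomes \<open>k + 2\<close>, which leaves the sign
    \<open>(-1) ^ k\<close>.\<close>
  also have "\<dots> = (\<Sum>k < card C. frag_cmul ((-1) ^ k) (?F (?xs ! k)))"
    using sum.atLeast1_atMost_eq[of
        "\<lambda>q. frag_cmul ((-1) ^ (q + 1)) (?F (?xs ! (q - 1)))" "p + 1"]
    by (simp add: assms)
  also have "\<dots> = (\<Sum>k < card C. frag_cmul (color_sign C (?xs ! k)) (?F (?xs ! k)))"
    by (intro sum.cong refl) (simp add: color_sign_sorted_list_of_set[OF fin])
  also have "\<dots> = (\<Sum>a \<in> C. frag_cmul (color_sign C a) (?F a))"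
  proof -
    have "bij_betw ((!) ?xs) {..<card C} C"
      by (rule bij_betw_nth) (use fin in auto)
    from sum.reindex_bij_betw[OF this, of "\<lambda>a. frag_cmul (color_sign C a) (?F a)"]
    show ?thesis .
  qed
  finally show ?thesis .
qed

section \<open>Signs of successive deletions and their cancellation\<close>

lemma color_sign_Diff_gt:
  assumes "a < b"
  shows "color_sign (C - {b}) a = color_sign C a"
proof -
  have "{x \<in> C - {b}. x < a} = {x \<in> C. x < a}" using assms by auto
  then show ?thesis by (simp only: color_sign_def)
qed

lemma color_sign_Diff_less:
  assumes "finite C" "a \<in> C" "a < b"
  shows "color_sign (C - {a}) b = - color_sign C b"
proof -
  let ?S = "{x \<in> C - {a}. x < b}"
  have "{x \<in> C. x < b} = insert a ?S" using assms by auto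
  moreover have "card (insert a ?S) = Suc (card ?S)"
    using assms(1) by (intro card_insert_disjoint) auto
  ultimately show ?thesis by (simp only: color_sign_def power_Suc)
qed

text \<open>Deleting the smaller of the two colors first flips the sign of the other one, while
  deleting the larger first changes nothing; so exactly one of the two products acquires a
  minus.\<close>

lemma color_sign_antisym:
  assumes "finite C" "a \<in> C" "b \<in> C" "a \<noteq> b"
  shows "color_sign C a * color_sign (C - {a}) b = - (color_sign C b * color_sign (C - {b}) a)"
proof (cases "a < b")
  case True
  then show ?thesis
    using assms(1,2) by (simp only: color_sign_Diff_gt color_sign_Diff_less) algebra
next
  case False
  then have "b < a" using assms(4) by simp
  then show ?thesis
    using assms(1,3) by (simp only: color_sign_Diff_gt color_sign_Diff_less) algebra
qed

text \<open>Swapping coordinates pairs the terms with \<open>a < b\<close> against those with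
  \<open>b < a\<close>. Splitting by the order avoids arguing that the sum equals its own negative,
  which does not force it to vanish in a group with 2-torsion.\<close>

lemma sum_antisym_eq_0:
  fixes f :: "'a::linorder \<Rightarrow> 'a \<Rightarrow> 'b::ab_group_add"
  assumes "finite C" "\<And>a b. \<lbrakk>a \<in> C; b \<in> C; a \<noteq> b\<rbrakk> \<Longrightarrow> f a b = - f b a"
  shows "(\<Sum>a \<in> C. \<Sum>b \<in> C - {a}. f a b) = 0"
proof -
  let ?L = "{(a, b) \<in> C \<times> C. a < b}" and ?G = "{(a, b) \<in> C \<times> C. b < a}"
  have fin: "finite ?L" "finite ?G"
    by (rule finite_subset[of _ "C \<times> C"]; use assms(1) in auto)+
  have "(\<Sum>a \<in> C. \<Sum>b \<in> C - {a}. f a b) = (\<Sum>(a, b) \<in> (SIGMA a:C. C - {a}). f a b)"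
    using assms(1) by (intro sum.Sigma) auto
  moreover have "(SIGMA a:C. C - {a}) = ?L \<union> ?G" by auto
  moreover have "(\<Sum>(a, b) \<in> ?L \<union> ?G. f a b) = (\<Sum>(a, b) \<in> ?L. f a b) + (\<Sum>(a, b) \<in> ?G. f a b)"
    by (rule sum.union_disjoint[OF fin]) auto
  moreover have "(\<Sum>(a, b) \<in> ?G. f a b) = (\<Sum>(a, b) \<in> ?L. - f a b)"
  proof (rule sum.reindex_bij_witness[of _ prod.swap prod.swap])
    fix x assume "x \<in> ?G"
    then obtain a b where "x = (a, b)" "a \<in> C" "b \<in> C" "a \<noteq> b" by auto
    then show "(case prod.swap x of (a, b) \<Rightarrow> - f a b) = (case x of (a, b) \<Rightarrow> f a b)"
      using assms(2)[of a b] by simp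
  qed auto
  moreover have "(\<Sum>(a, b) \<in> ?L. - f a b) = - (\<Sum>(a, b) \<in> ?L. f a b)"
    by (simp only: case_prod_beta' sum_negf)
  ultimately show ?thesis by (simp only: add.right_inverse)
qed

section \<open>The double boundary of a single bubble\<close>

lemma bubble_d_bubble_d_gen:
  assumes "finite (bverts B)" "(C, V) \<in> bubbles n B p" "p \<ge> 2"
  shows "frag_extend (bubble_d_gen n B (p - 1)) (bubble_d_gen n B p (C, V)) = 0"
proof -
  have C: "card C = p + 1" using assms(2,3) by (simp add: bubbles_def)
  then have fin: "finite C" using card.infinite by fastforce
  let ?F = "\<lambda>E V. \<Sum>x \<in> sub_bubbles n B (p - 2) E V. frag_of x"
  have inner: "frag_extend (bubble_d_gen n B (p - 1))
        (\<Sum>x \<in> sub_bubbles n B (p - 1) (C - {a}) V. frag_of x)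
      = (\<Sum>b \<in> C - {a}. frag_cmul (color_sign (C - {a}) b) (?F (C - {a} - {b}) V))"
    if a: "a \<in> C" for a
  proof -
    let ?S = "sub_bubbles n B (p - 1) (C - {a}) V"
    have Ca: "card (C - {a}) = p - 1 + 1" using C fin a assms(3) by simp
    have p: "p - 1 - 1 = p - 2" by simp
    have "frag_extend (bubble_d_gen n B (p - 1)) (\<Sum>x \<in> ?S. frag_of x)
        = (\<Sum>x \<in> ?S. bubble_d_gen n B (p - 1) x)"
      using frag_extend_sum[OF finite_sub_bubbles[OF assms(1)], of "bubble_d_gen n B (p - 1)" frag_of]
      by (simp add: comp_def)
    also have "\<dots> = (\<Sum>(D, W) \<in> ?S.
        \<Sum>b \<in> C - {a}. frag_cmul (color_sign (C - {a}) b) (?F (C - {a} - {b}) W))"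
    proof (rule sum.cong[OF refl])
      fix x assume "x \<in> ?S"
      then obtain W where x: "x = (C - {a}, W)" by (auto simp: sub_bubbles_def)
      show "bubble_d_gen n B (p - 1) x = (case x of (D, W) \<Rightarrow>
          \<Sum>b \<in> C - {a}. frag_cmul (color_sign (C - {a}) b) (?F (C - {a} - {b}) W))"
        by (simp only: x prod.case bubble_d_gen_eq[OF Ca] p)
    qed
    \<comment> \<open>The sign depends on the colors alone, so the sum over the intermediate bubbles
      \<open>W\<close> can be moved inside it.\<close>
    also have "\<dots> = (\<Sum>b \<in> C - {a}. frag_cmul (color_sign (C - {a}) b)
        (\<Sum>(D, W) \<in> ?S. ?F (C - {a} - {b}) W))"
      by (simp only: case_prod_beta' frag_cmul_sum) (rule sum.swap)
    also have "\<dots> = (\<Sum>b \<in> C - {a}. frag_cmul (color_sign (C - {a}) b) (?F (C - {a} - {b}) V))"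
    proof -
      \<comment> \<open>Here \<open>p \<ge> 2\<close> enters: the intermediate degree
        \<open>p - 1\<close> is at least 1, so the bubbles \<open>W\<close> are components and their
        contributions merge into the sum over \<open>V\<close>.\<close>
      have "(\<Sum>(D, W) \<in> ?S. ?F (C - {a} - {b}) W) = ?F (C - {a} - {b}) V" for b
        using assms(3) by (intro sum_sub_bubbles_sub_bubbles[OF assms(1,2) _ _ Ca]) auto
      then show ?thesis by (simp only:)
    qed
    finally show ?thesis .
  qed
  have "frag_extend (bubble_d_gen n B (p - 1)) (bubble_d_gen n B p (C, V))
      = (\<Sum>a \<in> C. frag_cmul (color_sign C a) (frag_extend (bubble_d_gen n B (p - 1))
          (\<Sum>x \<in> sub_bubbles n B (p - 1) (C - {a}) V. frag_of x)))"
    by (simp only: bubble_d_gen_eq[OF C] frag_extend_sum[OF fin] comp_def frag_extend_cmul)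
  also have "\<dots> = (\<Sum>a \<in> C. frag_cmul (color_sign C a)
      (\<Sum>b \<in> C - {a}. frag_cmul (color_sign (C - {a}) b) (?F (C - {a} - {b}) V)))"
    by (rule sum.cong[OF refl]) (simp only: inner)
  also have "\<dots> = (\<Sum>a \<in> C. \<Sum>b \<in> C - {a}.
      frag_cmul (color_sign C a * color_sign (C - {a}) b) (?F (C - {a} - {b}) V))"
    by (simp only: frag_cmul_sum frag_cmul_cmul)
  also have "\<dots> = 0"
  proof (rule sum_antisym_eq_0[OF fin])
    fix a b assume ab: "a \<in> C" "b \<in> C" "a \<noteq> b"
    \<comment> \<open>Both orders of deletion now have the same remaining colors inside the same
      \<open>V\<close>, so only the signs distinguish the two terms.\<close>
    have "C - {b} - {a} = C - {a} - {b}" by blast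
    then show "frag_cmul (color_sign C a * color_sign (C - {a}) b) (?F (C - {a} - {b}) V)
        = - frag_cmul (color_sign C b * color_sign (C - {b}) a) (?F (C - {b} - {a}) V)"
      by (simp only: color_sign_antisym[OF fin ab] minus_frag_cmul)
  qed
  finally show ?thesis .
qed

theorem lemma2:
  fixes n p :: nat and G :: "('v, 'l, 'h) cgft"
  assumes "n \<ge> 1"
    and "cgft_graph n G"
    and "1 \<le> p" and "p \<le> n"
  shows "\<forall>c \<in> carrier (free_Abelian_group (bubbles n (boundary_graph n G) p)).
    (bubble_d n (boundary_graph n G) (p - 1) \<circ> bubble_d n (boundary_graph n G) p) c = 0"
proof
  let ?B = "boundary_graph n G"
  fix c assume "c \<in> carrier (free_Abelian_group (bubbles n ?B p))"
  then have c: "Poly_Mapping.keys c \<subseteq> bubbles n ?B p" by simp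
  show "(bubble_d n ?B (p - 1) \<circ> bubble_d n ?B p) c = 0"
  \<comment> \<open>For \<open>p = 1\<close> the outer operator has degree 0 and is zero by
    definition, not a linear extension of \<open>bubble_d_gen\<close>.\<close>
  proof (cases "p = 1")
    case True
    then show ?thesis by (simp add: bubble_d_def)
  next
    case False
    then have p: "p \<ge> 2" using assms(3) by simp
    have fin: "finite (bverts ?B)"
      using cgft_graph.finite_halflines[OF assms(2)] by (simp add: boundary_graph_def)
    have "frag_extend (bubble_d_gen n ?B (p - 1)) (frag_extend (bubble_d_gen n ?B p) c) = 0"
      using c
    \<comment> \<open>Linearity reduces the claim to generators: the composite vanishes at 0 and is
      compatible with differences.\<close>
    proof (induction c rule: frag_induction)
      case (one x)
      then show ?case using bubble_d_bubble_d_gen[OF fin _ p] by (cases x) simp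
    qed (simp_all add: frag_extend_diff)
    then show ?thesis using p by (simp add: bubble_d_def)
  qed
qed

end
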